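(* Let $\mathcal{A} = (a_{i_1\cdots i_k})$ and $\mathcal{B} = (b_{i_1\cdots i_k})$ be two real symmetric tensors of order $k$ and dimension $n$, and let $$N_{\min}(\mathcal{A}) = \min \Big\{ \mathcal{A} x^k : x \in \mathbb{R}^n_+,\ \sum_{i=1}^n x_i^k = 1 \Big\}.$$ Then: (a) $\mathcal{A}$ is copositive if and only if $N_{\min}(\mathcal{A})\ge 0$; and $\mathcal{A}$ is strictly copositive if and only if $N_{\min}(\mathcal{A})>0$. (b) If $\mathcal{A}$ is copositive, then $d_{\min}(\mathcal{A}) \ge 0$. If $\mathcal{A}$ is strictly copositive, then $d_{\min}(\mathcal{A}) > 0$. (c) Suppose that $\mathcal{A} \le \mathcal{B}$. If $\mathcal{A}$ is copositive, then $\mathcal{B}$ is copositive. If $\mathcal{A}$ is strictly copositive, then $\mathcal{B}$ is strictly copositive.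
   Context: A real $k$th order $n$-dimensional tensor is an array $\mathcal{A}=(a_{i_1\cdots i_k})$ of real numbers, $i_1,\dots,i_k\in\{1,\dots,n\}$; it is symmetric if its entries are invariant under every permutation of the indices. For a vector $x$, $\mathcal{A}x^k = \sum_{i_1,\dots,i_k=1}^n a_{i_1\cdots i_k}x_{i_1}\cdots x_{i_k}$. $\mathbb{R}^n_+$ is the set of vectors in $\mathbb{R}^n$ with all components nonnegative. A real symmetric tensor $\mathcal{A}$ is copositive if $\mathcal{A}x^k\ge 0$ for all $x\in\mathbb{R}^n_+$, and strictly copositive if $\mathcal{A}x^k>0$ for all $x\in\mathbb{R}^n_+$, $x\ne 0$. $d_{\min}(\mathcal{A})=\min_{1\le i\le n}a_{i\cdots i}$ is the smallest diagonal element. $\mathcal{A}\le\mathcal{B}$ means $a_{i_1\cdots i_k}\le b_{i_1\cdots i_k}$ for all indices. *)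

theory Defs
  imports "HOL-Analysis.Analysis"
begin

text \<open>
  The order \<open>k\<close> and the dimension \<open>n\<close> of a tensor are carried by two finite index types:
  \<open>'k\<close> is the set of index positions, so \<open>k = CARD('k)\<close>, and \<open>'n\<close> is the range of each index, so
  \<open>n = CARD('n)\<close>; both are arbitrary positive numbers. A multi-index
  \<open>(i\<^sub>1, \<dots>, i\<^sub>k)\<close> is a function \<open>i :: 'k \<Rightarrow> 'n\<close>. The entrywise order on tensors is the
  pointwise order of functions.
\<close>

type_synonym ('k, 'n) tensor = "('k \<Rightarrow> 'n) \<Rightarrow> real"

definition symmetric_tensor :: "('k, 'n) tensor \<Rightarrow> bool" where
  "symmetric_tensor A \<longleftrightarrow> (\<forall>p i. bij p \<longrightarrow> A (i \<circ> p) = A i)"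

definition tensor_form :: "('k::finite, 'n::finite) tensor \<Rightarrow> real ^ 'n \<Rightarrow> real" where
  "tensor_form A x = (\<Sum>i\<in>UNIV. A i * (\<Prod>j\<in>UNIV. x $ (i j)))"

definition nonneg_orthant :: "(real ^ 'n) set" where
  "nonneg_orthant = {x. \<forall>i. 0 \<le> x $ i}"

definition copositive :: "('k::finite, 'n::finite) tensor \<Rightarrow> bool" where
  "copositive A \<longleftrightarrow> (\<forall>x\<in>nonneg_orthant. 0 \<le> tensor_form A x)"

definition strictly_copositive :: "('k::finite, 'n::finite) tensor \<Rightarrow> bool" where
  "strictly_copositive A \<longleftrightarrow> (\<forall>x\<in>nonneg_orthant. x \<noteq> 0 \<longrightarrow> 0 < tensor_form A x)"

definition d_min :: "('k, 'n::finite) tensor \<Rightarrow> real" where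
  "d_min A = Min (range (\<lambda>i. A (\<lambda>_. i)))"

text \<open>
  \<open>Min\<close> is only meaningful for finite sets, so the minimum over the infinite
  constraint set is expressed as the least element of the set of values. The lemma
  \<open>N_min_attained\<close> shows that this least element always exists.
\<close>

definition N_min :: "('k::finite, 'n::finite) tensor \<Rightarrow> real" where
  "N_min A = (LEAST m. m \<in> {tensor_form A x |x.
      x \<in> nonneg_orthant \<and> (\<Sum>i\<in>UNIV. (x $ i) ^ CARD('k)) = 1})"

lemma N_min_attained:
  fixes A :: "('k::finite, 'n::finite) tensor"
  defines "S \<equiv> {x \<in> nonneg_orthant. (\<Sum>i\<in>UNIV. (x $ i) ^ CARD('k)) = (1::real)}"
  shows "\<exists>x\<in>S. N_min A = tensor_form A x" and "\<forall>x\<in>S. N_min A \<le> tensor_form A x"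
proof -
  have "closed S"
  proof -
    have "S = (\<Inter>i. {x. 0 \<le> x $ i}) \<inter> {x. (\<Sum>i\<in>UNIV. (x $ i) ^ CARD('k)) = 1}"
      by (auto simp: S_def nonneg_orthant_def)
    then show ?thesis
      by (auto intro!: closed_Int closed_INT closed_Collect_le closed_Collect_eq
          continuous_intros)
  qed
  moreover have "S \<subseteq> cbox 0 1"
  proof
    fix x assume x: "x \<in> S"
    then have nn: "0 \<le> x $ i" for i by (auto simp: S_def nonneg_orthant_def)
    have "x $ i \<le> 1" for i
    proof (rule ccontr)
      assume "\<not> x $ i \<le> 1"
      then have "1 < (x $ i) ^ CARD('k)" by (intro one_less_power) auto
      also have "\<dots> \<le> (\<Sum>i\<in>UNIV. (x $ i) ^ CARD('k))"
        by (rule member_le_sum) (auto simp: nn)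
      finally show False using x by (simp add: S_def)
    qed
    with nn show "x \<in> cbox 0 1" by (simp add: mem_box_cart)
  qed
  ultimately have "compact S"
    by (meson bounded_cbox bounded_subset compact_eq_bounded_closed)
  moreover have "axis undefined 1 \<in> S"
    by (auto simp: S_def nonneg_orthant_def axis_def zero_power if_distrib[of "\<lambda>t. t ^ CARD('k)"] cong: if_cong)
  then have "S \<noteq> {}" by blast
  moreover have "continuous_on S (tensor_form A)"
    unfolding tensor_form_def by (intro continuous_intros)
  ultimately obtain x where x: "x \<in> S" "\<And>y. y \<in> S \<Longrightarrow> tensor_form A x \<le> tensor_form A y"
    using continuous_attains_inf by metis
  have "N_min A = tensor_form A x"
    unfolding N_min_def by (rule Least_equality) (use x in \<open>auto simp: S_def\<close>)
  with x show "\<exists>x\<in>S. N_min A = tensor_form A x" "\<forall>x\<in>S. N_min A \<le> tensor_form A x"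
    by auto
qed

end

theory Submission
  imports Defs
begin

text \<open>The form is homogeneous of degree k = \<open>CARD('k)\<close>
  (\<open>tensor_form_scaleR\<close>), so its sign along a ray of the orthant can be read off where
  the ray meets the slice on which the k-th powers of the coordinates sum to 1. On this compact
  slice the form attains its minimum \<open>N_min\<close>, whose sign therefore decides both kinds
  of copositivity. The diagonal entries are the values of the form at the unit vectors
  (\<open>tensor_form_axis\<close>), which gives the claim on \<open>d_min\<close>. On the orthant
  all monomials are nonnegative, so the form is monotone in the tensor
  (\<open>tensor_form_mono\<close>), and copositivity passes to larger tensors.\<close>

lemma tensor_form_scaleR:
  fixes A :: "('k::finite, 'n::finite) tensor"
  shows "tensor_form A (c *\<^sub>R x) = c ^ CARD('k) * tensor_form A x"
  by (simp add: tensor_form_def prod.distrib sum_distrib_left mult_ac)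

lemma tensor_form_zero: "tensor_form A 0 = 0"
  by (simp add: tensor_form_def zero_power)

text \<open>Every multi-index other than the constant one at \<open>m\<close> has a component at
  which the unit vector vanishes, which kills its monomial.\<close>

lemma tensor_form_axis:
  fixes A :: "('k::finite, 'n::finite) tensor"
  shows "tensor_form A (axis m 1) = A (\<lambda>_. m)"
proof -
  have "A i * (\<Prod>j\<in>UNIV. axis m 1 $ (i j)) = (if i = (\<lambda>_. m) then A i else 0)" for i :: "'k \<Rightarrow> 'n"
  proof (cases "i = (\<lambda>_. m)")
    case False
    then obtain j where "i j \<noteq> m" by auto
    then have "(\<Prod>j\<in>UNIV. axis m (1::real) $ (i j)) = 0"
      by (intro prod_zero) (auto simp: axis_def)
    with False show ?thesis by simp
  qed simp
  then show ?thesis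
    by (simp add: tensor_form_def)
qed

lemma tensor_form_mono:
  assumes "A \<le> B" and "x \<in> nonneg_orthant"
  shows "tensor_form A x \<le> tensor_form B x"
  using assms unfolding tensor_form_def nonneg_orthant_def
  by (intro sum_mono mult_right_mono prod_nonneg) (auto simp: le_fun_def)

text \<open>The scaling factor is the k-norm of \<open>x\<close>, the k-th root of the power sum;
  this sum is positive because one summand is positive and none is negative.\<close>

lemma nonneg_orthant_normalize:
  fixes x :: "real ^ 'n::finite"
  assumes "x \<in> nonneg_orthant" and "x \<noteq> 0" and "0 < k"
  obtains c y where "0 < c" "x = c *\<^sub>R y" "y \<in> nonneg_orthant" "(\<Sum>i\<in>UNIV. (y $ i) ^ k) = 1"
proof -
  define s where "s = (\<Sum>i\<in>UNIV. (x $ i) ^ k)"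
  have nonneg: "0 \<le> x $ i" for i
    using assms(1) by (simp add: nonneg_orthant_def)
  obtain m where "x $ m \<noteq> 0"
    using assms(2) by (auto simp: vec_eq_iff)
  with nonneg[of m] have "0 < (x $ m) ^ k" by simp
  also have "\<dots> \<le> s"
    unfolding s_def by (rule member_le_sum) (auto simp: nonneg)
  finally have s: "0 < s" .
  define c where "c = root k s"
  have c: "0 < c" "c ^ k = s"
    using s \<open>0 < k\<close> by (auto simp: c_def)
  show thesis
  proof
    show "x = c *\<^sub>R (inverse c *\<^sub>R x)" using c by simp
    show "inverse c *\<^sub>R x \<in> nonneg_orthant"
      using c nonneg by (simp add: nonneg_orthant_def)
    have "(\<Sum>i\<in>UNIV. ((inverse c *\<^sub>R x) $ i) ^ k) = inverse (c ^ k) * s"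
      by (simp add: s_def power_mult_distrib power_inverse sum_distrib_left)
    then show "(\<Sum>i\<in>UNIV. ((inverse c *\<^sub>R x) $ i) ^ k) = 1"
      using c s by simp
  qed (fact c)
qed

text \<open>Homogeneity carries the bound from the slice to the whole ray; the factor obtained is
  the k-th power of the normalizing scalar, and only its positivity matters later.\<close>

lemma tensor_form_ge_N_min:
  fixes A :: "('k::finite, 'n::finite) tensor"
  assumes "x \<in> nonneg_orthant" and "x \<noteq> 0"
  obtains c where "0 < c" "c * N_min A \<le> tensor_form A x"
proof -
  obtain c y where cy: "0 < c" "x = c *\<^sub>R y" "y \<in> nonneg_orthant"
      "(\<Sum>i\<in>UNIV. (y $ i) ^ CARD('k)) = 1"
    using nonneg_orthant_normalize[OF assms, of "CARD('k)"] by auto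
  then have "N_min A \<le> tensor_form A y"
    using N_min_attained(2)[of A] by auto
  then have "c ^ CARD('k) * N_min A \<le> tensor_form A x"
    using cy by (simp add: tensor_form_scaleR)
  moreover have "0 < c ^ CARD('k)" using cy by simp
  ultimately show thesis by (rule that[rotated])
qed

text \<open>A minimizer on the slice is nonzero, since k is positive and the power sum of the zero
  vector is then 0, not 1.\<close>

lemma N_min_witness:
  fixes A :: "('k::finite, 'n::finite) tensor"
  obtains x where "x \<in> nonneg_orthant" "x \<noteq> 0" "N_min A = tensor_form A x"
  using N_min_attained(1)[of A] by (force simp: zero_power)

lemma copositive_iff_N_min: "copositive A \<longleftrightarrow> 0 \<le> N_min A"
proof
  assume "copositive A"
  then show "0 \<le> N_min A"
    by (metis N_min_witness copositive_def)
next
  assume N: "0 \<le> N_min A"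
  show "copositive A"
    unfolding copositive_def
  proof
    fix x :: "real ^ 'b"
    assume x: "x \<in> nonneg_orthant"
    show "0 \<le> tensor_form A x"
    \<comment> \<open>The origin lies on no ray through the slice, but the form vanishes
      there.\<close>
    proof (cases "x = 0")
      case False
      then obtain c where c: "0 < c" "c * N_min A \<le> tensor_form A x"
        using tensor_form_ge_N_min x by blast
      have "0 \<le> c * N_min A" using c N by simp
      with c show ?thesis by linarith
    qed (simp add: tensor_form_zero)
  qed
qed

lemma strictly_copositive_iff_N_min: "strictly_copositive A \<longleftrightarrow> 0 < N_min A"
proof
  assume "strictly_copositive A"
  then show "0 < N_min A"
    by (metis N_min_witness strictly_copositive_def)
next
  assume "0 < N_min A"
  then show "strictly_copositive A"
    unfolding strictly_copositive_def
    by (metis tensor_form_ge_N_min mult_pos_pos less_le_trans)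
qed

lemma axis_in_nonneg_orthant: "axis m 1 \<in> nonneg_orthant"
  by (simp add: nonneg_orthant_def axis_def)

text \<open>This turns \<open>d_min\<close> into a value of the form on the orthant, to which the
  definitions of copositivity apply directly.\<close>

lemma d_min_attained: obtains m where "d_min A = tensor_form A (axis m 1)"
proof -
  have "d_min A \<in> range (\<lambda>m. A (\<lambda>_. m))"
    unfolding d_min_def by (rule Min_in) auto
  with that show thesis by (force simp only: tensor_form_axis)
qed

lemma copositive_d_min: "copositive A \<Longrightarrow> 0 \<le> d_min A"
  using d_min_attained[of A] axis_in_nonneg_orthant unfolding copositive_def by metis

lemma strictly_copositive_d_min:
  assumes "strictly_copositive A"
  shows "0 < d_min A"
proof -
  obtain m where "d_min A = tensor_form A (axis m 1)"
    by (rule d_min_attained)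
  moreover have "axis m (1::real) \<noteq> 0"
    by (simp add: axis_eq_0_iff)
  ultimately show ?thesis
    using assms axis_in_nonneg_orthant[of m] by (simp add: strictly_copositive_def)
qed

lemma copositive_mono: "A \<le> B \<Longrightarrow> copositive A \<Longrightarrow> copositive B"
  by (auto simp: copositive_def intro: order_trans[OF _ tensor_form_mono])

lemma strictly_copositive_mono: "A \<le> B \<Longrightarrow> strictly_copositive A \<Longrightarrow> strictly_copositive B"
  by (auto simp: strictly_copositive_def intro: less_le_trans[OF _ tensor_form_mono])

theorem theorem5:
  fixes A B :: "('k::finite, 'n::finite) tensor"
  assumes "symmetric_tensor A" and "symmetric_tensor B"
  shows "(copositive A \<longleftrightarrow> N_min A \<ge> 0) \<and>
         (strictly_copositive A \<longleftrightarrow> N_min A > 0) \<and>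
         (copositive A \<longrightarrow> d_min A \<ge> 0) \<and>
         (strictly_copositive A \<longrightarrow> d_min A > 0) \<and>
         (A \<le> B \<longrightarrow>
           (copositive A \<longrightarrow> copositive B) \<and>
           (strictly_copositive A \<longrightarrow> strictly_copositive B))"
  by (intro conjI impI copositive_iff_N_min strictly_copositive_iff_N_min
      copositive_d_min strictly_copositive_d_min copositive_mono[of A B]
      strictly_copositive_mono[of A B])

end
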